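(* Let $D<0$ be an integer with $D\equiv1\pmod4$. There exist integers $a,b$ with $$D=b^2-4a^2,\qquad |b|\leqslant a,\qquad \gcd(a,b)=1$$ if and only if $D$ factors as $D=-FG$ with $F,G$ relatively prime positive integers satisfying $$\frac13\leqslant\frac FG\leqslant3.$$ *)

theory Defs
  imports Complex_Main "HOL-Number_Theory.Cong"
begin

end

theory Submission
  imports Defs
begin

text \<open>The substitution \<open>F = 2a - b\<close>, \<open>G = 2a + b\<close> gives \<open>b\<^sup>2 - 4a\<^sup>2 = -FG\<close>. Since \<open>D \<equiv> 1 (mod 4)\<close>,
  both factors are odd with \<open>4\<close> dividing \<open>F + G\<close>, so the substitution is invertible over the
  integers; the condition \<open>\<bar>b\<bar> \<le> a\<close> becomes \<open>G \<le> 3F\<close> and \<open>F \<le> 3G\<close>.\<close>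

text \<open>A common divisor divides the sum \<open>4 * a\<close> and the difference
  \<open>2 * b\<close>. It is odd because \<open>2 * a - b\<close> is odd, so the factors 4 and 2
  cancel.\<close>

lemma coprime_twice_diff_sum:
  fixes a b :: int
  assumes "coprime a b" "odd b"
  shows "coprime (2 * a - b) (2 * a + b)"
proof (rule coprimeI)
  fix c assume c: "c dvd 2 * a - b" "c dvd 2 * a + b"
  have "odd c"
    using c(1) \<open>odd b\<close> by (metis dvd_trans even_diff even_mult_iff even_numeral even_add)
  hence "coprime c 2" "coprime c 4"
    using coprime_power_right_iff[of c 2 2] by (auto simp: coprime_right_2_iff_odd)
  moreover have "c dvd 4 * a" "c dvd 2 * b"
    using dvd_add[OF c] dvd_diff[OF c(2,1)] by (simp_all add: algebra_simps)
  ultimately have "c dvd a" "c dvd b"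
    by (simp_all add: coprime_dvd_mult_right_iff)
  thus "is_unit c"
    using \<open>coprime a b\<close> by (meson coprime_common_divisor)
qed

text \<open>Residues with product 3 modulo 4 must be 1 and 3 in some order. This makes
  \<open>F + G = 4 * a\<close> solvable when \<open>a\<close> and \<open>b\<close> are recovered
  from the factors.\<close>

lemma dvd_4_add_of_mult_mod_4:
  fixes F G :: int
  assumes "(F * G) mod 4 = 3"
  shows "4 dvd F + G"
proof -
  have "(F mod 4) * (G mod 4) mod 4 = 3"
    using assms by (simp add: mod_mult_eq)
  moreover have "F mod 4 \<in> {0, 1, 2, 3}" "G mod 4 \<in> {0, 1, 2, 3}"
    by auto
  ultimately have "(F mod 4 + G mod 4) mod 4 = 0"
    by auto
  thus ?thesis
    by (simp add: mod_add_eq dvd_eq_mod_eq_0)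
qed

lemma ratio_between_third_and_3_iff:
  fixes F G :: int
  assumes "G > 0"
  shows "1 / 3 \<le> real_of_int F / real_of_int G \<and> real_of_int F / real_of_int G \<le> 3
    \<longleftrightarrow> G \<le> 3 * F \<and> F \<le> 3 * G"
proof -
  have "1 / 3 \<le> real_of_int F / real_of_int G \<longleftrightarrow> real_of_int G \<le> real_of_int (3 * F)"
    "real_of_int F / real_of_int G \<le> 3 \<longleftrightarrow> real_of_int F \<le> real_of_int (3 * G)"
    using assms by (simp_all add: field_simps)
  thus ?thesis
    unfolding of_int_le_iff by simp
qed

theorem proposition12:
  fixes D :: int
  assumes "D < 0" and "[D = 1] (mod 4)"
  shows "(\<exists>a b :: int. D = b ^ 2 - 4 * a ^ 2 \<and> \<bar>b\<bar> \<le> a \<and> gcd a b = 1) \<longleftrightarrow>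
    (\<exists>F G :: int. F > 0 \<and> G > 0 \<and> coprime F G \<and> D = - (F * G) \<and>
      1 / 3 \<le> real_of_int F / real_of_int G \<and> real_of_int F / real_of_int G \<le> 3)"
    (is "?L \<longleftrightarrow> ?R")
proof
  have D: "D mod 4 = 1"
    using assms(2) by (simp add: cong_def)
  {
    assume ?L
    then obtain a b where ab: "D = b ^ 2 - 4 * a ^ 2" "\<bar>b\<bar> \<le> a" "coprime a b"
      by (auto simp: coprime_iff_gcd_eq_1)
    \<comment> \<open>The bound on \<open>b\<close> gives \<open>a >= 0\<close>, and
      \<open>a = 0\<close> would force \<open>b = 0\<close>, hence \<open>D = 0\<close>.\<close>
    have "a > 0"
      using ab \<open>D < 0\<close> by (cases "a = 0") auto
    have "odd D"
      using D by presburger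
    hence "odd b"
      using ab(1) by simp
    have pos: "2 * a - b > 0" "2 * a + b > 0"
      using \<open>a > 0\<close> ab(2) by linarith+
    have "D = - ((2 * a - b) * (2 * a + b))"
      using ab(1) by (simp add: algebra_simps power2_eq_square)
    \<comment> \<open>These reduce to \<open>4 * b <= 4 * a\<close> and
      \<open>-4 * b <= 4 * a\<close>.\<close>
    moreover have "2 * a + b \<le> 3 * (2 * a - b)" "2 * a - b \<le> 3 * (2 * a + b)"
      using ab(2) by (simp_all add: abs_le_iff)
    ultimately show ?R
      using pos coprime_twice_diff_sum[OF ab(3) \<open>odd b\<close>] ratio_between_third_and_3_iff[OF pos(2)]
      by blast
  next
    assume ?R
    then obtain F G where FG: "coprime F G" "D = - (F * G)" "G \<le> 3 * F" "F \<le> 3 * G"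
      using ratio_between_third_and_3_iff by blast
    have "(F * G) mod 4 = 3"
      using D FG(2) by presburger
    then obtain a where a: "F + G = 4 * a"
      using dvd_4_add_of_mult_mod_4 by (meson dvdE)
    \<comment> \<open>Solves \<open>F = 2 * a - b\<close>; then \<open>G = 4 * a - F\<close> equals
      \<open>2 * a + b\<close>.\<close>
    define b where "b = 2 * a - F"
    have F: "F = 2 * a - b" and G: "G = 2 * a + b"
      using a by (simp_all add: b_def)
    have "D = b ^ 2 - 4 * a ^ 2"
      using FG(2) by (simp add: F G algebra_simps power2_eq_square)
    moreover have "\<bar>b\<bar> \<le> a"
      using FG(3,4) F G by linarith
    \<comment> \<open>\<open>F\<close> and \<open>G\<close> are integer combinations of
      \<open>a\<close> and \<open>b\<close>, so their coprimality passes to \<open>a\<close> and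
      \<open>b\<close>.\<close>
    moreover have "gcd a b dvd F" "gcd a b dvd G"
      unfolding F G by simp_all
    hence "is_unit (gcd a b)"
      using FG(1) by (meson coprime_common_divisor)
    hence "gcd a b = 1"
      by simp
    ultimately show ?L
      by (intro exI conjI)
  }
qed

end
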